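(* There exists an open and dense semi-algebraic subset $\mathcal{O}$ of $\mathbb{R}^{n\times\rho}$ such that the polynomial mapping $f(x)=a+Q^T\mathrm{vec}(x)$ is $\mathcal{D}_0$ for every $(a,Q)\in\mathcal{O}$.
   Context: Fix $n$ and $d$. Let $\mathbb{R}_d[x]$ be the space of polynomials in $x=(x_1,\dots,x_n)$ with real coefficients of degree at most $d$, and let $\rho$ be its dimension. Let $$\mathrm{vec}(x)=(x_1,\dots,x_n,x_1^2,x_1x_2,\dots,x_n^2,\dots,x_n^d)^T$$ be the vector of all $\rho-1$ nonconstant monomials of degree at most $d$. Every $f=(f_1,\dots,f_n)\in\mathbb{R}_d[x]^n$ is uniquely written $f_i(x)=a_i+Q_i^T\mathrm{vec}(x)$ with $a_i\in\mathbb{R}$, $Q_i\in\mathbb{R}^{\rho-1}$; in short $f(x)=a+Q^T\mathrm{vec}(x)$ with $a=(a_1,\dots,a_n)$ and $Q=(Q_1,\dots,Q_n)$. The parameter space of pairs $(a,Q)$ is identified with $\mathbb{R}^{n\times\rho}$. A real polynomial mapping $f=(f_1,\dots,f_n)$ is called $\mathcal{D}_0$ if the set $\{x\in\mathbb{C}^n: x_1f_1(x)=\dots=x_nf_n(x)=0\}$ is finite. *)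

theory Defs
  imports "HOL-Analysis.Analysis" "HOL-Library.Poly_Mapping"
begin

text \<open>
  Multivariate polynomials are finitely supported maps from exponent vectors to coefficients;
  the ring operations are those of \<^theory>\<open>HOL-Library.Poly_Mapping\<close>.
\<close>

type_synonym 'v monomial = "'v \<Rightarrow>\<^sub>0 nat"
type_synonym 'v rpoly = "'v monomial \<Rightarrow>\<^sub>0 real"

definition monom_eval :: "'v monomial \<Rightarrow> ('v \<Rightarrow> 'b::comm_monoid_mult) \<Rightarrow> 'b" where
  "monom_eval m x = (\<Prod>v\<in>Poly_Mapping.keys m. x v ^ Poly_Mapping.lookup m v)"

text \<open>Real polynomials are evaluated at real as well as at complex points.\<close>

definition poly_eval :: "'v rpoly \<Rightarrow> ('v \<Rightarrow> 'b::real_normed_field) \<Rightarrow> 'b" where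
  "poly_eval p x =
     (\<Sum>m\<in>Poly_Mapping.keys p. of_real (Poly_Mapping.lookup p m) * monom_eval m x)"

definition monom_degree :: "'v monomial \<Rightarrow> nat" where
  "monom_degree m = (\<Sum>v\<in>Poly_Mapping.keys m. Poly_Mapping.lookup m v)"

text \<open>
  For a finite type of \<open>n\<close> variables, \<open>monomials d\<close> has \<open>\<rho>\<close> elements, and
  \<open>nonconst_monomials d\<close> indexes the \<open>\<rho> - 1\<close> entries of \<open>vec(x)\<close>.
\<close>

definition monomials :: "nat \<Rightarrow> 'v monomial set" where
  "monomials d = {m. monom_degree m \<le> d}"

definition nonconst_monomials :: "nat \<Rightarrow> 'v monomial set" where
  "nonconst_monomials d = monomials d - {0}"

lemma finite_monomials: "finite (monomials d :: ('n::finite) monomial set)"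
proof -
  have "Poly_Mapping.lookup m v \<le> d" if "m \<in> monomials d" for m :: "'n monomial" and v
  proof (cases "v \<in> Poly_Mapping.keys m")
    case True
    then have "Poly_Mapping.lookup m v \<le> monom_degree m"
      unfolding monom_degree_def by (intro member_le_sum) auto
    then show ?thesis using that by (simp add: monomials_def)
  qed (simp add: in_keys_iff)
  then have "Poly_Mapping.lookup ` (monomials d :: 'n monomial set) \<subseteq> (UNIV \<rightarrow>\<^sub>E {..d})"
    by auto
  moreover have "finite ((UNIV :: 'n set) \<rightarrow>\<^sub>E {..d})"
    by (intro finite_PiE) auto
  ultimately have "finite (Poly_Mapping.lookup ` (monomials d :: 'n monomial set))"
    by (rule finite_subset)
  then show ?thesis
    by (rule finite_imageD) (simp add: inj_on_def poly_mapping_eqI)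
qed

text \<open>The mapping \<open>f(x) = a + Q\<^sup>T vec(x)\<close>; here \<open>Q i m\<close> is the entry of \<open>Q\<^sub>i\<close> at the monomial \<open>m\<close>.\<close>

definition poly_map_of ::
    "nat \<Rightarrow> ('n \<Rightarrow> real) \<Rightarrow> ('n \<Rightarrow> 'n monomial \<Rightarrow> real) \<Rightarrow> 'n \<Rightarrow> 'n rpoly" where
  "poly_map_of d a Q i =
     Poly_Mapping.single 0 (a i) + (\<Sum>m\<in>nonconst_monomials d. Poly_Mapping.single m (Q i m))"

definition is_D0 :: "('n::finite \<Rightarrow> 'n rpoly) \<Rightarrow> bool" where
  "is_D0 f \<longleftrightarrow> finite {x :: complex ^ 'n. \<forall>i. x $ i * poly_eval (f i) (\<lambda>j. x $ j) = 0}"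

text \<open>
  Since \<open>\<rho>\<close> depends on \<open>d\<close>, the parameter space of \<open>n \<times> \<rho>\<close> matrices is not a type: its elements
  are the functions on \<open>param_index d\<close>, extended by \<^const>\<open>undefined\<close>, i.e. the points of
  \<open>powertop_real (param_index d)\<close>. The column of the monomial 0 holds \<open>a\<close>, the others hold \<open>Q\<close>.
\<close>

definition param_index :: "nat \<Rightarrow> ('n \<times> 'n monomial) set" where
  "param_index d = UNIV \<times> monomials d"

definition param ::
    "nat \<Rightarrow> ('n \<Rightarrow> real) \<Rightarrow> ('n \<Rightarrow> 'n monomial \<Rightarrow> real) \<Rightarrow> 'n \<times> 'n monomial \<Rightarrow> real" where
  "param d a Q = restrict (\<lambda>(i, m). if m = 0 then a i else Q i m) (param_index d)"

text \<open>
  Semi-algebraic subsets of \<open>\<real>\<^sup>I\<close> for a finite index set \<open>I\<close>: the smallest family of subsets that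
  contains the sets \<open>{x. p x > 0}\<close> for real polynomials \<open>p\<close> in the variables \<open>I\<close> and is closed
  under finite unions and complements, hence also under finite intersections.
\<close>

inductive semialgebraic :: "'v set \<Rightarrow> ('v \<Rightarrow> real) set \<Rightarrow> bool" for I where
  positive: "(\<And>m. m \<in> Poly_Mapping.keys p \<Longrightarrow> Poly_Mapping.keys m \<subseteq> I) \<Longrightarrow>
     semialgebraic I {x \<in> I \<rightarrow>\<^sub>E UNIV. poly_eval p x > 0}"
| complement: "semialgebraic I S \<Longrightarrow> semialgebraic I ((I \<rightarrow>\<^sub>E UNIV) - S)"
| union: "semialgebraic I S \<Longrightarrow> semialgebraic I T \<Longrightarrow> semialgebraic I (S \<union> T)"

end

theory Submission
  imports "Jordan_Normal_Form.Spectral_Radius" Defs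
begin

text \<open>
  Let \<open>n\<close> be the number of variables. By the pigeonhole principle every monomial \<open>\<mu>\<close> of degree
  \<open>n * d + 1\<close> is divisible by some \<open>x\<^sub>i\<^bsup>d+1\<^esup>\<close>, so \<open>(\<mu> / x\<^sub>i\<^sup>d) f\<^sub>i\<close> is a polynomial multiple of \<open>x\<^sub>i f\<^sub>i\<close>
  of degree at most \<open>n * d + 1\<close>. The coefficients of these polynomials at the monomials of
  degree \<open>n * d + 1\<close> form a square matrix, a variant of Macaulay's matrix for resultants. Its
  determinant is a polynomial in the coefficients of \<open>f\<close>, and the set \<open>\<O>\<close> is where it
  does not vanish. This set is open and semi-algebraic.

  It is dense because the matrix is linear in \<open>f\<close> and equals the identity for
  \<open>f = (x\<^sub>1\<^sup>d, \<dots>, x\<^sub>n\<^sup>d)\<close>: moving \<open>f\<close> in that direction adds a multiple of the identity to its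
  matrix, which is singular for finitely many multiples only
  (\<open>finite_singular_perturbations\<close>).

  If the matrix is invertible, then on the common zeros of the \<open>x\<^sub>i f\<^sub>i\<close> every monomial of degree
  \<open>n * d + 1\<close> is a fixed linear combination of monomials of degree at most \<open>n * d\<close>
  (\<open>reduce_monomial\<close>). So multiplication by \<open>x\<^sub>i\<close> acts on the values of the latter through a fixed
  matrix, and \<open>x\<^sub>i\<close> is one of its eigenvalues (\<open>finite_coordinate_values\<close>). Each coordinate of a
  common zero therefore takes finitely many values.
\<close>

section \<open>Matrices indexed by finite sets\<close>

hide_const (open) Finite_Cartesian_Product.mat Finite_Cartesian_Product.vec Determinants.det
no_notation vec_index (infixl "$" 100)
notation vec_index (infixl "$v" 100)

text \<open>
  Rows and columns are indexed by monomials below, whereas matrices have natural numbers as indices.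
  The order of enumeration does not matter, since all results are read back in terms of \<open>S\<close>.
\<close>

definition set_matrix :: "'a set \<Rightarrow> ('a \<Rightarrow> 'a \<Rightarrow> 'k) \<Rightarrow> 'k mat" where
  "set_matrix S M =
     mat (card S) (card S) (\<lambda>(i, j). M (from_nat_into S i) (from_nat_into S j))"

lemma set_matrix_carrier [simp]: "set_matrix S M \<in> carrier_mat (card S) (card S)"
  by (simp add: set_matrix_def)

lemma sum_from_nat_into:
  assumes "finite S"
  shows "(\<Sum>i = 0..<card S. g (from_nat_into S i)) = (\<Sum>s\<in>S. g s)"
  using sum.reindex_bij_betw[OF bij_betw_from_nat_into_finite[OF assms], of g]
  by (simp add: atLeast0LessThan)

lemma set_matrix_mult_vec:
  assumes "finite S" "i < card S"
  shows "(set_matrix S M *\<^sub>v vec (card S) (\<lambda>j. v (from_nat_into S j))) $v i =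
    (\<Sum>t\<in>S. M (from_nat_into S i) t * v t)"
  using assms sum_from_nat_into[OF assms(1), of "\<lambda>t. M (from_nat_into S i) t * v t"]
  by (simp add: set_matrix_def scalar_prod_def)

lemma obtain_index:
  assumes "finite S" "s \<in> S"
  obtains i where "i < card S" "from_nat_into S i = s"
  using bij_betw_imp_surj_on[OF bij_betw_from_nat_into_finite[OF assms(1)]] assms(2)
  by (metis imageE lessThan_iff)

lemma from_nat_into_mem:
  assumes "finite S" "i < card S"
  shows "from_nat_into S i \<in> S"
  using assms by (metis card.empty from_nat_into less_nat_zero_code)

text \<open>
  This is used twice: for the real Macaulay matrix, to perturb it into an invertible one, and for
  the complex matrices of multiplication by a coordinate, to confine that coordinate.
\<close>

lemma finite_eigenvalues:
  fixes A :: "'a \<Rightarrow> 'a \<Rightarrow> 'k::field"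
  assumes S: "finite S"
  shows "finite {k. \<exists>v. (\<exists>s\<in>S. v s \<noteq> 0) \<and> (\<forall>s\<in>S. (\<Sum>t\<in>S. A s t * v t) = k * v s)}"
    (is "finite ?E")
proof (rule finite_subset)
  show "?E \<subseteq> spectrum (set_matrix S A)"
  proof
    fix k assume "k \<in> ?E"
    then obtain v s where s: "s \<in> S" "v s \<noteq> 0"
      and ev: "\<And>s. s \<in> S \<Longrightarrow> (\<Sum>t\<in>S. A s t * v t) = k * v s"
      by blast
    let ?w = "vec (card S) (\<lambda>j. v (from_nat_into S j))"
    obtain i where "i < card S" "from_nat_into S i = s"
      using obtain_index[OF S s(1)] .
    then have "?w $v i \<noteq> 0\<^sub>v (card S) $v i" using s(2) by simp
    then have "?w \<noteq> 0\<^sub>v (card S)" by metis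
    moreover have "set_matrix S A *\<^sub>v ?w = k \<cdot>\<^sub>v ?w"
    proof (rule eq_vecI)
      fix i assume "i < dim_vec (k \<cdot>\<^sub>v ?w)"
      then have "i < card S" by simp
      then show "(set_matrix S A *\<^sub>v ?w) $v i = (k \<cdot>\<^sub>v ?w) $v i"
        by (simp add: set_matrix_mult_vec S ev from_nat_into_mem del: index_mult_mat_vec)
    qed (simp add: set_matrix_def)
    ultimately have "eigenvector (set_matrix S A) ?w k"
      by (simp add: eigenvector_def set_matrix_def)
    then show "k \<in> spectrum (set_matrix S A)"
      by (auto simp: spectrum_def eigenvalue_def)
  qed
  show "finite (spectrum (set_matrix S A))"
    by (rule card_finite_spectrum(1)) (rule set_matrix_carrier)
qed

lemma det_zero_kernel:
  fixes M :: "'a \<Rightarrow> 'a \<Rightarrow> 'k::field"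
  assumes S: "finite S" and "det (set_matrix S M) = 0"
  obtains v where "\<exists>s\<in>S. v s \<noteq> 0" "\<And>s. s \<in> S \<Longrightarrow> (\<Sum>t\<in>S. M s t * v t) = 0"
proof -
  obtain w where w: "w \<in> carrier_vec (card S)" "w \<noteq> 0\<^sub>v (card S)"
      "set_matrix S M *\<^sub>v w = 0\<^sub>v (card S)"
    using assms(2) det_0_iff_vec_prod_zero_field[OF set_matrix_carrier] by blast
  define v where "v s = w $v inv_into {..<card S} (from_nat_into S) s" for s
  have inj: "inj_on (from_nat_into S) {..<card S}"
    using bij_betw_from_nat_into_finite[OF S] by (simp add: bij_betw_def)
  have vi: "v (from_nat_into S i) = w $v i" if "i < card S" for i
    using that inj by (simp add: v_def inv_into_f_f)
  have wv: "w = vec (card S) (\<lambda>j. v (from_nat_into S j))"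
    using w(1) by (intro eq_vecI) (auto simp: vi)
  obtain i where "i < card S" "w $v i \<noteq> 0"
    using w(1,2) by (metis carrier_vecD eq_vecI index_zero_vec)
  then have "\<exists>s\<in>S. v s \<noteq> 0"
    using S by (auto simp: vi intro!: bexI[of _ "from_nat_into S i"] from_nat_into_mem)
  moreover have "(\<Sum>t\<in>S. M s t * v t) = 0" if s: "s \<in> S" for s
  proof -
    obtain i where "i < card S" "from_nat_into S i = s"
      using obtain_index[OF S s] .
    then show ?thesis
      using set_matrix_mult_vec[OF S, of i M v] w(3) wv by auto
  qed
  ultimately show ?thesis using that by blast
qed

text \<open>The inverse is the adjugate divided by the determinant.\<close>

lemma det_nonzero_left_inverse:
  fixes M :: "'a \<Rightarrow> 'a \<Rightarrow> 'k::field"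
  assumes S: "finite S" and det: "det (set_matrix S M) \<noteq> 0"
  obtains B where
    "\<And>s t. s \<in> S \<Longrightarrow> t \<in> S \<Longrightarrow> (\<Sum>r\<in>S. B s r * M r t) = (if s = t then 1 else 0)"
proof -
  let ?n = "card S" and ?A = "set_matrix S M"
  define idx where "idx = inv_into {..<?n} (from_nat_into S)"
  have bij: "bij_betw (from_nat_into S) {..<?n} S"
    using bij_betw_from_nat_into_finite[OF S] .
  have idx: "idx s < ?n" "from_nat_into S (idx s) = s" if "s \<in> S" for s
    using bij_betw_inv_into_right[OF bij that] bij_betw_apply[OF bij_betw_inv_into[OF bij] that]
    by (auto simp: idx_def)
  have idx': "idx (from_nat_into S i) = i" if "i < ?n" for i
    using bij_betw_inv_into_left[OF bij] that by (simp add: idx_def)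
  define B where "B s r = adj_mat ?A $$ (idx s, idx r) / det ?A" for s r
  have "(\<Sum>r\<in>S. B s r * M r t) = (if s = t then 1 else 0)" if "s \<in> S" "t \<in> S" for s t
  proof -
    have "(\<Sum>r\<in>S. B s r * M r t) =
        (\<Sum>i = 0..<?n. adj_mat ?A $$ (idx s, i) * ?A $$ (i, idx t)) / det ?A"
      unfolding sum_from_nat_into[OF S, symmetric] sum_divide_distrib
      using that idx by (intro sum.cong) (auto simp: B_def idx' set_matrix_def)
    also have "(\<Sum>i = 0..<?n. adj_mat ?A $$ (idx s, i) * ?A $$ (i, idx t)) =
        (adj_mat ?A * ?A) $$ (idx s, idx t)"
      using idx that carrier_matD[OF adj_mat(1)[OF set_matrix_carrier[of S M]]]
        carrier_matD[OF set_matrix_carrier[of S M]]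
      by (simp add: scalar_prod_def)
    also have "\<dots> = det ?A * (if idx s = idx t then 1 else 0)"
      using adj_mat(3)[of ?A ?n] idx that by simp
    also have "(idx s = idx t) = (s = t)"
      using idx that by metis
    finally show ?thesis using det by simp
  qed
  then show ?thesis using that by blast
qed

section \<open>Evaluation of polynomials\<close>

lemma monom_eval_superset:
  assumes "finite A" "Poly_Mapping.keys m \<subseteq> A"
  shows "monom_eval m x = (\<Prod>v\<in>A. x v ^ Poly_Mapping.lookup m v)"
  unfolding monom_eval_def
  by (rule prod.mono_neutral_left) (use assms in \<open>auto simp: not_in_keys_iff_lookup_eq_zero\<close>)

lemma monom_eval_add: "monom_eval (m + n) x = monom_eval m x * monom_eval n x"
proof -
  let ?A = "Poly_Mapping.keys m \<union> Poly_Mapping.keys n"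
  have "monom_eval (m + n) x = (\<Prod>v\<in>?A. x v ^ Poly_Mapping.lookup (m + n) v)"
    by (rule monom_eval_superset) (auto dest: subsetD[OF Poly_Mapping.keys_add])
  then show ?thesis
    by (simp add: monom_eval_superset[of ?A] lookup_add power_add prod.distrib)
qed

lemma monom_eval_zero [simp]: "monom_eval 0 x = 1"
  by (simp add: monom_eval_def)

lemma monom_eval_variable [simp]: "monom_eval (Poly_Mapping.single v 1) x = x v"
  by (simp add: monom_eval_def)

lemma monom_degree_UNIV: "monom_degree (m :: 'n::finite monomial) = (\<Sum>v\<in>UNIV. Poly_Mapping.lookup m v)"
  unfolding monom_degree_def
  by (rule sum.mono_neutral_left) (auto simp: not_in_keys_iff_lookup_eq_zero)

lemma monom_degree_add:
  "monom_degree (m + n) = monom_degree m + monom_degree (n :: 'n::finite monomial)"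
  by (simp add: monom_degree_UNIV lookup_add sum.distrib)

lemma monom_degree_single: "monom_degree (Poly_Mapping.single v k) = k"
  by (cases "k = 0") (simp_all add: monom_degree_def)

lemma poly_eval_superset:
  assumes "finite A" "Poly_Mapping.keys p \<subseteq> A"
  shows "poly_eval p x = (\<Sum>m\<in>A. of_real (Poly_Mapping.lookup p m) * monom_eval m x)"
  unfolding poly_eval_def
  by (rule sum.mono_neutral_left) (use assms in \<open>auto simp: not_in_keys_iff_lookup_eq_zero\<close>)

lemma poly_eval_add: "poly_eval (p + q) x = poly_eval p x + poly_eval q x"
proof -
  let ?A = "Poly_Mapping.keys p \<union> Poly_Mapping.keys q"
  have "poly_eval (p + q) x =
      (\<Sum>m\<in>?A. of_real (Poly_Mapping.lookup (p + q) m) * monom_eval m x)"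
    by (rule poly_eval_superset) (auto dest: subsetD[OF Poly_Mapping.keys_add])
  then show ?thesis
    by (simp add: poly_eval_superset[of ?A] lookup_add distrib_right sum.distrib)
qed

lemma poly_eval_zero [simp]: "poly_eval 0 x = 0"
  by (simp add: poly_eval_def)

lemma poly_eval_single [simp]:
  "poly_eval (Poly_Mapping.single m c) x = of_real c * monom_eval m x"
  by (cases "c = 0") (simp_all add: poly_eval_def)

lemma poly_eval_sum: "poly_eval (\<Sum>k\<in>K. p k) x = (\<Sum>k\<in>K. poly_eval (p k) x)"
  by (induction K rule: infinite_finite_induct) (simp_all add: poly_eval_add)

lemma poly_mapping_sum_singles:
  "p = (\<Sum>m\<in>Poly_Mapping.keys p. Poly_Mapping.single m (Poly_Mapping.lookup p m))"
  by (rule poly_mapping_eqI)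
    (simp add: lookup_sum lookup_single when_def sum.delta not_in_keys_iff_lookup_eq_zero
      cong: if_cong)

lemma poly_eval_mult: "poly_eval (p * q) x = poly_eval p x * poly_eval q x"
proof -
  have "p * q = (\<Sum>m\<in>Poly_Mapping.keys p. \<Sum>n\<in>Poly_Mapping.keys q.
      Poly_Mapping.single (m + n) (Poly_Mapping.lookup p m * Poly_Mapping.lookup q n))"
    by (subst poly_mapping_sum_singles[of p], subst poly_mapping_sum_singles[of q])
      (simp add: sum_product mult_single)
  then show ?thesis
    by (simp add: poly_eval_sum monom_eval_add)
      (simp add: poly_eval_def sum_product mult_ac)
qed

section \<open>Polynomial functions of the parameters\<close>

text \<open>
  Polynomials in the variables \<open>I\<close> as functions on real points: closure under sums and products
  makes the determinant of a matrix of such functions one of them.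
\<close>

definition polynomial_on :: "'v set \<Rightarrow> (('v \<Rightarrow> real) \<Rightarrow> real) \<Rightarrow> bool" where
  "polynomial_on I f \<longleftrightarrow>
     (\<exists>p. (\<forall>m\<in>Poly_Mapping.keys p. Poly_Mapping.keys m \<subseteq> I) \<and> f = poly_eval p)"

lemma polynomial_on_const: "polynomial_on I (\<lambda>x. c)"
  unfolding polynomial_on_def
  by (intro exI[of _ "Poly_Mapping.single 0 c"]) (auto simp: fun_eq_iff)

lemma polynomial_on_variable: "v \<in> I \<Longrightarrow> polynomial_on I (\<lambda>x. x v)"
  unfolding polynomial_on_def
  by (intro exI[of _ "Poly_Mapping.single (Poly_Mapping.single v 1) 1"])
    (auto simp: fun_eq_iff simp del: One_nat_def)

lemma polynomial_on_add:
  assumes "polynomial_on I f" "polynomial_on I g"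
  shows "polynomial_on I (\<lambda>x. f x + g x)"
proof -
  from assms obtain p q where
    pq: "\<forall>m\<in>Poly_Mapping.keys p. Poly_Mapping.keys m \<subseteq> I" "f = poly_eval p"
    "\<forall>m\<in>Poly_Mapping.keys q. Poly_Mapping.keys m \<subseteq> I" "g = poly_eval q"
    by (auto simp: polynomial_on_def)
  have "\<forall>m\<in>Poly_Mapping.keys (p + q). Poly_Mapping.keys m \<subseteq> I"
    using pq Poly_Mapping.keys_add[of p q] by blast
  then show ?thesis
    unfolding polynomial_on_def
    by (intro exI[of _ "p + q"]) (simp add: poly_eval_add fun_eq_iff pq)
qed

lemma polynomial_on_mult:
  assumes "polynomial_on I f" "polynomial_on I g"
  shows "polynomial_on I (\<lambda>x. f x * g x)"
proof -
  from assms obtain p q where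
    pq: "\<forall>m\<in>Poly_Mapping.keys p. Poly_Mapping.keys m \<subseteq> I" "f = poly_eval p"
    "\<forall>m\<in>Poly_Mapping.keys q. Poly_Mapping.keys m \<subseteq> I" "g = poly_eval q"
    by (auto simp: polynomial_on_def)
  have "Poly_Mapping.keys m \<subseteq> I" if m: "m \<in> Poly_Mapping.keys (p * q)" for m
  proof -
    obtain a b where "m = a + b" "a \<in> Poly_Mapping.keys p" "b \<in> Poly_Mapping.keys q"
      using m keys_mult[of p q] by blast
    then show ?thesis
      using pq Poly_Mapping.keys_add[of a b] by blast
  qed
  then show ?thesis
    unfolding polynomial_on_def
    by (intro exI[of _ "p * q"]) (auto simp: poly_eval_mult fun_eq_iff pq)
qed

lemma polynomial_on_sum:
  assumes "\<And>k. k \<in> K \<Longrightarrow> polynomial_on I (f k)"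
  shows "polynomial_on I (\<lambda>x. \<Sum>k\<in>K. f k x)"
  using assms
  by (induction K rule: infinite_finite_induct)
    (simp_all add: polynomial_on_const polynomial_on_add)

lemma polynomial_on_prod:
  assumes "\<And>k. k \<in> K \<Longrightarrow> polynomial_on I (f k)"
  shows "polynomial_on I (\<lambda>x. \<Prod>k\<in>K. f k x)"
  using assms
  by (induction K rule: infinite_finite_induct)
    (simp_all add: polynomial_on_const polynomial_on_mult)

lemma polynomial_on_det:
  assumes S: "finite S" and M: "\<And>s t. s \<in> S \<Longrightarrow> t \<in> S \<Longrightarrow> polynomial_on I (\<lambda>x. M x s t)"
  shows "polynomial_on I (\<lambda>x. det (set_matrix S (M x)))"
  unfolding det_def'[OF set_matrix_carrier]
proof (intro polynomial_on_sum polynomial_on_mult polynomial_on_prod polynomial_on_const)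
  fix p i assume "p \<in> {p. p permutes {0..<card S}}" "i \<in> {0..<card S}"
  moreover from this have "p i < card S"
    using permutes_in_image[of p "{0..<card S}" i] by simp
  ultimately show "polynomial_on I (\<lambda>x. set_matrix S (M x) $$ (i, p i))"
    using S by (simp add: set_matrix_def M from_nat_into_mem)
qed

lemma polynomial_on_continuous:
  assumes "polynomial_on I f"
  shows "continuous_map (powertop_real I) euclideanreal f"
proof -
  obtain p where p: "\<forall>m\<in>Poly_Mapping.keys p. Poly_Mapping.keys m \<subseteq> I" "f = poly_eval p"
    using assms by (auto simp: polynomial_on_def)
  then have "f = (\<lambda>x. \<Sum>m\<in>Poly_Mapping.keys p. Poly_Mapping.lookup p m *
      (\<Prod>v\<in>Poly_Mapping.keys m. x v ^ Poly_Mapping.lookup m v))"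
    by (simp add: fun_eq_iff poly_eval_def monom_eval_def)
  moreover have "continuous_map (powertop_real I) euclideanreal \<dots>"
    using p(1)
    by (intro continuous_map_sum continuous_map_real_mult_left continuous_map_prod
        continuous_map_real_pow continuous_map_product_projection) auto
  ultimately show ?thesis by simp
qed

lemma nonvanishing_open:
  assumes "polynomial_on I f"
  shows "openin (powertop_real I) {x \<in> I \<rightarrow>\<^sub>E UNIV. f x \<noteq> 0}"
  using openin_continuous_map_preimage[OF polynomial_on_continuous[OF assms], of "- {0}"]
  by (simp add: open_Compl)

text \<open>The condition \<open>f x \<noteq> 0\<close> is the single inequality \<open>f x * f x > 0\<close>.\<close>

lemma nonvanishing_semialgebraic:
  assumes "polynomial_on I f"
  shows "semialgebraic I {x \<in> I \<rightarrow>\<^sub>E UNIV. f x \<noteq> 0}"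
proof -
  have "polynomial_on I (\<lambda>x. f x * f x)"
    using assms assms by (rule polynomial_on_mult)
  then obtain p where p: "\<forall>m\<in>Poly_Mapping.keys p. Poly_Mapping.keys m \<subseteq> I"
      "(\<lambda>x. f x * f x) = poly_eval p"
    by (auto simp: polynomial_on_def)
  have "semialgebraic I {x \<in> I \<rightarrow>\<^sub>E UNIV. poly_eval p x > (0::real)}"
    using p(1) by (intro semialgebraic.positive) auto
  also have "(\<lambda>x. poly_eval p x > 0) = (\<lambda>x. f x \<noteq> 0)"
    unfolding p(2)[symmetric] by (auto simp: fun_eq_iff zero_less_mult_iff)
  finally show ?thesis .
qed

section \<open>The Macaulay matrix\<close>

text \<open>
  The degree \<open>n * d + 1\<close> is the least one in which every monomial has an exponent
  greater than \<open>d\<close>.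
\<close>

definition top_monomials :: "nat \<Rightarrow> 'n::finite monomial set" where
  "top_monomials d = {m. monom_degree m = CARD('n) * d + 1}"

definition low_monomials :: "nat \<Rightarrow> 'n::finite monomial set" where
  "low_monomials d = {m. monom_degree m \<le> CARD('n) * d}"

text \<open>
  For \<open>\<mu>\<close> of top degree with pivot \<open>i\<close>, the monomial \<open>shift d \<mu>\<close> is \<open>\<mu> / x\<^sub>i\<^sup>d\<close>, still divisible
  by \<open>x\<^sub>i\<close>. The row of \<open>\<mu>\<close> in the Macaulay matrix lists the coefficients of the polynomial
  \<open>shift d \<mu> * f\<^sub>i\<close>, a multiple of \<open>x\<^sub>i f\<^sub>i\<close> of degree at most \<open>n * d + 1\<close>. A column \<open>\<nu>\<close> may be any
  monomial; the square matrix of interest has its columns in \<open>top_monomials d\<close>.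
\<close>

definition pivot :: "nat \<Rightarrow> 'n::finite monomial \<Rightarrow> 'n" where
  "pivot d \<mu> = (SOME i. d < Poly_Mapping.lookup \<mu> i)"

definition shift :: "nat \<Rightarrow> 'n::finite monomial \<Rightarrow> 'n monomial" where
  "shift d \<mu> = \<mu> - Poly_Mapping.single (pivot d \<mu>) d"

definition macaulay ::
    "nat \<Rightarrow> ('n \<times> 'n monomial \<Rightarrow> real) \<Rightarrow> 'n::finite monomial \<Rightarrow> 'n monomial \<Rightarrow> real" where
  "macaulay d c \<mu> \<nu> =
     (\<Sum>m\<in>monomials d. if m + shift d \<mu> = \<nu> then c (pivot d \<mu>, m) else 0)"

lemma finite_top_monomials: "finite (top_monomials d :: 'n::finite monomial set)"
  by (rule finite_subset[OF _ finite_monomials[of "CARD('n) * d + 1"]])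
    (auto simp: top_monomials_def monomials_def)

lemma finite_low_monomials: "finite (low_monomials d :: 'n::finite monomial set)"
  using finite_monomials[of "CARD('n) * d", where ?'n = 'n]
  by (simp add: low_monomials_def monomials_def)

text \<open>By the pigeonhole principle: \<open>n\<close> exponents that are at most \<open>d\<close> have sum at most \<open>n * d\<close>.\<close>

lemma pivot_exponent:
  fixes \<mu> :: "'n::finite monomial"
  assumes "\<mu> \<in> top_monomials d"
  shows "d < Poly_Mapping.lookup \<mu> (pivot d \<mu>)"
proof -
  have "\<exists>i. d < Poly_Mapping.lookup \<mu> i"
  proof (rule ccontr)
    assume "\<not> ?thesis"
    then have "(\<Sum>i\<in>UNIV. Poly_Mapping.lookup \<mu> i) \<le> (\<Sum>i\<in>(UNIV :: 'n set). d)"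
      by (intro sum_mono) (simp add: not_less)
    with assms show False
      by (simp add: top_monomials_def monom_degree_UNIV)
  qed
  then show ?thesis unfolding pivot_def by (rule someI_ex)
qed

lemma shift_add_pivot:
  assumes "\<mu> \<in> top_monomials d"
  shows "Poly_Mapping.single (pivot d \<mu>) d + shift d \<mu> = \<mu>"
  using pivot_exponent[OF assms]
  by (intro poly_mapping_eqI)
    (auto simp: shift_def lookup_add lookup_minus lookup_single when_def)

lemma pivot_divides_shift:
  assumes "\<mu> \<in> top_monomials d"
  shows "0 < Poly_Mapping.lookup (shift d \<mu>) (pivot d \<mu>)"
  using pivot_exponent[OF assms] by (simp add: shift_def lookup_minus)

lemma monom_degree_shift:
  fixes \<mu> :: "'n::finite monomial"
  assumes "\<mu> \<in> top_monomials d"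
  shows "d + monom_degree (shift d \<mu>) = CARD('n) * d + 1"
  using assms arg_cong[OF shift_add_pivot[OF assms], of monom_degree]
  by (simp add: top_monomials_def monom_degree_add monom_degree_single)

text \<open>
  The matrix is linear in the coefficients, and it is the identity for \<open>f\<^sub>i = x\<^sub>i\<^sup>d\<close>, because then
  \<open>shift d \<mu> * f\<^sub>i = \<mu>\<close>. Hence adding \<open>s x\<^sub>i\<^sup>d\<close> to every \<open>f\<^sub>i\<close> adds \<open>s\<close> times the identity.
\<close>

lemma macaulay_perturb:
  assumes \<mu>: "\<mu> \<in> top_monomials d"
  shows "macaulay d (\<lambda>(i, m). c (i, m) + (if m = Poly_Mapping.single i d then s else 0)) \<mu> \<nu> =
    macaulay d c \<mu> \<nu> + (if \<mu> = \<nu> then s else 0)"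
proof -
  let ?e = "Poly_Mapping.single (pivot d \<mu>) d"
  have "(\<Sum>m\<in>monomials d. if m + shift d \<mu> = \<nu> then if m = ?e then s else 0 else 0) =
      (\<Sum>m\<in>monomials d. if m = ?e then if \<mu> = \<nu> then s else 0 else 0)"
    by (rule sum.cong) (auto simp: shift_add_pivot[OF \<mu>])
  also have "\<dots> = (if \<mu> = \<nu> then s else 0)"
  proof -
    have "?e \<in> monomials d" by (simp add: monomials_def monom_degree_single)
    then show ?thesis by (simp add: finite_monomials)
  qed
  finally have eq: "(if \<mu> = \<nu> then s else 0) =
      (\<Sum>m\<in>monomials d. if m + shift d \<mu> = \<nu> then if m = ?e then s else 0 else 0)" ..
  show ?thesis
    unfolding macaulay_def eq sum.distrib[symmetric] by (intro sum.cong) auto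
qed

lemma macaulay_restrict:
  "macaulay d (restrict c (param_index d)) \<mu> \<nu> = macaulay d c \<mu> \<nu>"
  unfolding macaulay_def by (rule sum.cong) (auto simp: param_index_def)

lemma polynomial_on_macaulay:
  "polynomial_on (param_index d) (\<lambda>c. macaulay d c \<mu> \<nu>)"
  unfolding macaulay_def
proof (rule polynomial_on_sum)
  fix m :: "'a monomial" assume "m \<in> monomials d"
  then show "polynomial_on (param_index d)
      (\<lambda>c. if m + shift d \<mu> = \<nu> then c (pivot d \<mu>, m) else 0)"
    by (cases "m + shift d \<mu> = \<nu>")
      (simp_all add: polynomial_on_const polynomial_on_variable param_index_def)
qed

definition macaulay_det :: "nat \<Rightarrow> ('n::finite \<times> 'n monomial \<Rightarrow> real) \<Rightarrow> real" where
  "macaulay_det d c = det (set_matrix (top_monomials d) (macaulay d c))"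

lemma polynomial_on_macaulay_det: "polynomial_on (param_index d) (macaulay_det d)"
  using polynomial_on_det[OF finite_top_monomials polynomial_on_macaulay]
  by (simp add: macaulay_det_def[abs_def])

section \<open>Density of the nonsingular parameters\<close>

text \<open>The perturbed matrix is singular only if \<open>- s\<close> is an eigenvalue of the unperturbed one.\<close>

lemma finite_singular_perturbations:
  fixes c :: "'n::finite \<times> 'n monomial \<Rightarrow> real"
  shows "finite {s. macaulay_det d (restrict
     (\<lambda>(i, m). c (i, m) + (if m = Poly_Mapping.single i d then s else 0)) (param_index d)) = 0}"
    (is "finite {s. macaulay_det d (?c s) = 0}")
proof -
  let ?T = "top_monomials d :: 'n monomial set"
  let ?E = "{k. \<exists>v. (\<exists>\<mu>\<in>?T. v \<mu> \<noteq> 0) \<and>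
    (\<forall>\<mu>\<in>?T. (\<Sum>\<nu>\<in>?T. macaulay d c \<mu> \<nu> * v \<nu>) = k * v \<mu>)}"
  have "{s. macaulay_det d (?c s) = 0} \<subseteq> uminus ` ?E"
  proof
    fix s assume "s \<in> {s. macaulay_det d (?c s) = 0}"
    then have "det (set_matrix ?T (macaulay d (?c s))) = 0"
      by (simp add: macaulay_det_def)
    then obtain v where v: "\<exists>\<mu>\<in>?T. v \<mu> \<noteq> 0"
      and ker: "\<And>\<mu>. \<mu> \<in> ?T \<Longrightarrow> (\<Sum>\<nu>\<in>?T. macaulay d (?c s) \<mu> \<nu> * v \<nu>) = 0"
      using det_zero_kernel[OF finite_top_monomials] by blast
    have "(\<Sum>\<nu>\<in>?T. macaulay d c \<mu> \<nu> * v \<nu>) = - s * v \<mu>" if \<mu>: "\<mu> \<in> ?T" for \<mu>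
    proof -
      have "(\<Sum>\<nu>\<in>?T. macaulay d c \<mu> \<nu> * v \<nu>) + s * v \<mu> =
          (\<Sum>\<nu>\<in>?T. macaulay d c \<mu> \<nu> * v \<nu> + (if \<mu> = \<nu> then s * v \<nu> else 0))"
        using \<mu> by (simp add: sum.distrib finite_top_monomials)
      also have "\<dots> = (\<Sum>\<nu>\<in>?T. macaulay d (?c s) \<mu> \<nu> * v \<nu>)"
        unfolding macaulay_restrict macaulay_perturb[OF \<mu>]
        by (rule sum.cong) (auto simp: distrib_right)
      also have "\<dots> = 0" by (rule ker[OF \<mu>])
      finally show ?thesis by simp
    qed
    with v have "- s \<in> ?E" by blast
    then show "s \<in> uminus ` ?E" by (rule rev_image_eqI) simp
  qed
  then show ?thesis
    by (rule finite_subset) (intro finite_imageI finite_eigenvalues finite_top_monomials)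
qed

text \<open>
  A neighbourhood of \<open>c\<close> contains infinitely many points of the line through \<open>c\<close> in the direction
  of \<open>(x\<^sub>1\<^sup>d, \<dots>, x\<^sub>n\<^sup>d)\<close>, and only finitely many points of the line are singular.
\<close>

lemma macaulay_det_nonzero_dense:
  "(powertop_real (param_index d)) closure_of
     {c \<in> param_index d \<rightarrow>\<^sub>E UNIV. macaulay_det d c \<noteq> 0} =
   topspace (powertop_real (param_index d :: ('n::finite \<times> 'n monomial) set))"
  unfolding dense_intersects_open
proof (intro allI impI)
  fix W :: "('n \<times> 'n monomial \<Rightarrow> real) set"
  let ?I = "param_index d :: ('n \<times> 'n monomial) set"
  let ?X = "powertop_real ?I"
  assume "openin ?X W \<and> W \<noteq> {}"
  then obtain c where W: "openin ?X W" and c: "c \<in> W" by blast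
  define line where "line s = restrict
    (\<lambda>(i, m). c (i, m) + (if m = Poly_Mapping.single i d then s else 0)) ?I" for s :: real
  have cont: "continuous_map euclideanreal ?X line"
    unfolding continuous_map_componentwise
  proof (intro conjI ballI)
    fix k assume "k \<in> ?I"
    then have "(\<lambda>s. line s k) =
        (\<lambda>s. c k + (if snd k = Poly_Mapping.single (fst k) d then s else 0))"
      by (simp add: fun_eq_iff line_def case_prod_beta)
    then show "continuous_map euclideanreal euclideanreal (\<lambda>s. line s k)"
      by (cases "snd k = Poly_Mapping.single (fst k) d") (auto intro!: continuous_intros)
  qed (auto simp: line_def)
  have "c \<in> extensional ?I"
    using openin_subset[OF W] c by (auto simp: PiE_def)
  then have "line 0 = c"
    by (auto simp: line_def fun_eq_iff extensional_def restrict_def)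
  then have "0 \<in> {s. line s \<in> W}" using c by simp
  moreover have "open {s. line s \<in> W}"
    using openin_continuous_map_preimage[OF cont W] by simp
  ultimately have "infinite {s. line s \<in> W}"
    using finite_imp_not_open by blast
  moreover have "finite {s. macaulay_det d (line s) = 0}"
    unfolding line_def by (rule finite_singular_perturbations)
  ultimately obtain s where "line s \<in> W" "macaulay_det d (line s) \<noteq> 0"
    by (metis (mono_tags, lifting) finite_subset mem_Collect_eq subsetI)
  moreover have "line s \<in> ?I \<rightarrow>\<^sub>E UNIV" by (simp add: line_def)
  ultimately have "line s \<in> {c \<in> ?I \<rightarrow>\<^sub>E UNIV. macaulay_det d c \<noteq> 0} \<inter> W"
    by simp
  then show "{c \<in> ?I \<rightarrow>\<^sub>E UNIV. macaulay_det d c \<noteq> 0} \<inter> W \<noteq> {}"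
    by (metis emptyE)
qed

section \<open>Finiteness of the zero set\<close>

lemma poly_eval_poly_map_of:
  fixes x :: "'n::finite \<Rightarrow> complex"
  shows "poly_eval (poly_map_of d a Q i) x =
     (\<Sum>m\<in>monomials d. of_real (param d a Q (i, m)) * monom_eval m x)"
proof -
  have z: "0 \<in> (monomials d :: 'n monomial set)"
    by (simp add: monomials_def monom_degree_def)
  have "poly_eval (poly_map_of d a Q i) x =
      of_real (a i) + (\<Sum>m\<in>nonconst_monomials d. of_real (Q i m) * monom_eval m x)"
    by (simp add: poly_map_of_def poly_eval_add poly_eval_sum)
  also have "(\<Sum>m\<in>nonconst_monomials d. of_real (Q i m) * monom_eval m x) =
      (\<Sum>m\<in>nonconst_monomials d. of_real (param d a Q (i, m)) * monom_eval m x)"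
    by (rule sum.cong) (auto simp: param_def param_index_def nonconst_monomials_def)
  also have "of_real (a i) = of_real (param d a Q (i, 0)) * monom_eval 0 x"
    using z by (simp add: param_def param_index_def)
  finally show ?thesis
    by (simp only: nonconst_monomials_def sum.remove[OF finite_monomials z])
qed

lemma monom_eval_eq_zero:
  assumes "x v = 0" "0 < Poly_Mapping.lookup m v"
  shows "monom_eval m x = (0 :: complex)"
proof -
  have "v \<in> Poly_Mapping.keys m" using assms(2) by (simp add: in_keys_iff)
  then show ?thesis
    unfolding monom_eval_def using assms by (intro prod_zero) (auto intro: bexI[of _ v])
qed

definition zero_set :: "nat \<Rightarrow> ('n::finite \<times> 'n monomial \<Rightarrow> real) \<Rightarrow> ('n \<Rightarrow> complex) set" where
  "zero_set d c =
     {x. \<forall>i. x i * (\<Sum>m\<in>monomials d. of_real (c (i, m)) * monom_eval m x) = 0}"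

text \<open>
  The row of \<open>\<mu>\<close> is the equation \<open>x\<^bsup>shift d \<mu>\<^esup> f\<^sub>i(x) = 0\<close> with \<open>i = pivot d \<mu>\<close>. It follows from
  \<open>x\<^sub>i f\<^sub>i(x) = 0\<close> because \<open>x\<^sub>i\<close> divides the shift. The part of degree at most
  \<open>n * d\<close> is moved to the right.
\<close>

lemma macaulay_equation:
  fixes c :: "'n::finite \<times> 'n monomial \<Rightarrow> real"
  assumes x: "x \<in> zero_set d c" and \<mu>: "\<mu> \<in> top_monomials d"
  shows "(\<Sum>\<nu>\<in>top_monomials d. of_real (macaulay d c \<mu> \<nu>) * monom_eval \<nu> x) =
    - (\<Sum>\<nu>\<in>low_monomials d. of_real (macaulay d c \<mu> \<nu>) * monom_eval \<nu> x)"
proof -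
  let ?i = "pivot d \<mu>" and ?A = "top_monomials d \<union> low_monomials d :: 'n monomial set"
  have fin: "finite ?A" by (simp add: finite_top_monomials finite_low_monomials)
  have mem: "m + shift d \<mu> \<in> ?A" if "m \<in> monomials d" for m
    using that monom_degree_shift[OF \<mu>]
    by (auto simp: monomials_def top_monomials_def low_monomials_def monom_degree_add)
  have "(\<Sum>\<nu>\<in>?A. of_real (macaulay d c \<mu> \<nu>) * monom_eval \<nu> x) =
      (\<Sum>\<nu>\<in>?A. \<Sum>m\<in>monomials d.
        if m + shift d \<mu> = \<nu> then of_real (c (?i, m)) * monom_eval (m + shift d \<mu>) x else 0)"
    by (intro sum.cong refl)
      (auto simp: macaulay_def of_real_sum sum_distrib_right intro!: sum.cong)
  also have "\<dots> = (\<Sum>m\<in>monomials d. of_real (c (?i, m)) * monom_eval (m + shift d \<mu>) x)"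
    unfolding sum.swap[of _ "monomials d"]
    by (intro sum.cong refl) (simp only: sum.delta'[OF fin] mem if_True)
  also have "\<dots> = monom_eval (shift d \<mu>) x *
      (\<Sum>m\<in>monomials d. of_real (c (?i, m)) * monom_eval m x)"
    by (simp add: monom_eval_add sum_distrib_left mult_ac)
  also have "\<dots> = 0"
    using x monom_eval_eq_zero[OF _ pivot_divides_shift[OF \<mu>], of x]
    by (auto simp: zero_set_def)
  finally have "(\<Sum>\<nu>\<in>?A. of_real (macaulay d c \<mu> \<nu>) * monom_eval \<nu> x) = 0" .
  moreover have "top_monomials d \<inter> low_monomials d = ({} :: 'n monomial set)"
    by (auto simp: top_monomials_def low_monomials_def)
  ultimately show ?thesis
    by (simp add: sum.union_disjoint finite_top_monomials finite_low_monomials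
        eq_neg_iff_add_eq_0)
qed

text \<open>
  Inverting the Macaulay matrix solves the system of its equations for the monomials of degree
  \<open>n * d + 1\<close>. The coefficients do not depend on the point of the zero set.
\<close>

lemma reduce_monomial:
  fixes c :: "'n::finite \<times> 'n monomial \<Rightarrow> real"
  assumes det: "macaulay_det d c \<noteq> 0" and \<nu>: "\<nu> \<in> top_monomials d \<union> low_monomials d"
  shows "\<exists>b. \<forall>x\<in>zero_set d c.
    monom_eval \<nu> x = (\<Sum>m\<in>low_monomials d. b m * monom_eval m x)"
proof (cases "\<nu> \<in> low_monomials d")
  case True
  have "monom_eval \<nu> x =
      (\<Sum>m\<in>low_monomials d. (if m = \<nu> then 1 else 0) * monom_eval m x)" for x :: "'n \<Rightarrow> complex"
    using True by (simp add: finite_low_monomials if_distrib[of "\<lambda>b. b * _"] cong: if_cong)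
  then show ?thesis by (intro exI[of _ "\<lambda>m. if m = \<nu> then 1 else 0"] ballI)
next
  case False
  let ?T = "top_monomials d :: 'n monomial set" and ?L = "low_monomials d :: 'n monomial set"
  have \<nu>T: "\<nu> \<in> ?T" using \<nu> False by blast
  obtain B where B: "\<And>s t. s \<in> ?T \<Longrightarrow> t \<in> ?T \<Longrightarrow>
      (\<Sum>r\<in>?T. B s r * macaulay d c r t) = (if s = t then 1 else 0)"
    using det_nonzero_left_inverse[OF finite_top_monomials det[unfolded macaulay_det_def]]
    by blast
  define b where "b m = - (\<Sum>\<mu>\<in>?T. complex_of_real (B \<nu> \<mu> * macaulay d c \<mu> m))" for m
  have "monom_eval \<nu> x = (\<Sum>m\<in>?L. b m * monom_eval m x)"
    if x: "x \<in> zero_set d c" for x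
  proof -
    have "monom_eval \<nu> x = (\<Sum>t\<in>?T. (if \<nu> = t then 1 else 0) * monom_eval t x)"
      using \<nu>T by (simp add: finite_top_monomials if_distrib[of "\<lambda>b. b * _"] cong: if_cong)
    also have "\<dots> = (\<Sum>t\<in>?T. of_real (\<Sum>\<mu>\<in>?T. B \<nu> \<mu> * macaulay d c \<mu> t) * monom_eval t x)"
      using B[OF \<nu>T] by (intro sum.cong) auto
    also have "\<dots> = (\<Sum>\<mu>\<in>?T. of_real (B \<nu> \<mu>) *
        (\<Sum>t\<in>?T. of_real (macaulay d c \<mu> t) * monom_eval t x))"
      unfolding of_real_sum sum_distrib_left sum_distrib_right
      by (subst sum.swap) (simp add: mult_ac)
    also have "\<dots> = (\<Sum>\<mu>\<in>?T. of_real (B \<nu> \<mu>) *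
        - (\<Sum>m\<in>?L. of_real (macaulay d c \<mu> m) * monom_eval m x))"
      by (intro sum.cong refl) (simp only: macaulay_equation[OF x])
    also have "\<dots> = (\<Sum>m\<in>?L. b m * monom_eval m x)"
      unfolding b_def of_real_sum sum_distrib_left sum_distrib_right sum_negf[symmetric]
      by (subst sum.swap) (simp add: sum_negf sum_distrib_right sum_distrib_left mult_ac)
    finally show ?thesis .
  qed
  then show ?thesis by (intro exI[of _ b] ballI)
qed

text \<open>
  On the zero set, multiplication by \<open>x\<^sub>i\<close> maps the span of the low monomials to itself. Its
  matrix \<open>A\<close> is the same at all points, and the vector of values of the low monomials at \<open>x\<close> is
  an eigenvector of \<open>A\<close> for the eigenvalue \<open>x\<^sub>i\<close>; it is nonzero because the monomial 1 is low.
\<close>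

lemma finite_coordinate_values:
  fixes c :: "'n::finite \<times> 'n monomial \<Rightarrow> real"
  assumes det: "macaulay_det d c \<noteq> 0"
  shows "finite ((\<lambda>x. x i) ` zero_set d c)"
proof -
  let ?L = "low_monomials d :: 'n monomial set"
  let ?e = "Poly_Mapping.single i 1 :: 'n monomial"
  have "\<forall>s\<in>?L. \<exists>b. \<forall>x\<in>zero_set d c.
      monom_eval (?e + s) x = (\<Sum>m\<in>?L. b m * monom_eval m x)"
  proof (intro ballI reduce_monomial[OF det])
    fix s assume "s \<in> ?L"
    then show "?e + s \<in> top_monomials d \<union> ?L"
      by (auto simp: top_monomials_def low_monomials_def monom_degree_add monom_degree_single)
  qed
  from bchoice[OF this] obtain A where A: "\<forall>s\<in>?L. \<forall>x\<in>zero_set d c.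
      monom_eval (?e + s) x = (\<Sum>m\<in>?L. A s m * monom_eval m x)" ..
  have "(\<lambda>x. x i) ` zero_set d c \<subseteq> {k. \<exists>v. (\<exists>s\<in>?L. v s \<noteq> 0) \<and>
      (\<forall>s\<in>?L. (\<Sum>t\<in>?L. A s t * v t) = k * v s)}"
  proof (intro subsetI CollectI, elim imageE, intro exI conjI ballI)
    fix k x assume k: "k = x i" and x: "x \<in> zero_set d c"
    show "\<exists>s\<in>?L. monom_eval s x \<noteq> 0"
      by (intro bexI[of _ 0]) (simp_all add: low_monomials_def monom_degree_def)
    fix s assume s: "s \<in> ?L"
    have "(\<Sum>t\<in>?L. A s t * monom_eval t x) = monom_eval (?e + s) x"
      using A s x by simp
    then show "(\<Sum>t\<in>?L. A s t * monom_eval t x) = k * monom_eval s x"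
      unfolding monom_eval_add monom_eval_variable k .
  qed
  then show ?thesis
    using finite_eigenvalues[OF finite_low_monomials] by (rule finite_subset)
qed

lemma macaulay_det_nonzero_imp_D0:
  assumes det: "macaulay_det d (param d a Q) \<noteq> 0"
  shows "is_D0 (poly_map_of d a Q :: 'n::finite \<Rightarrow> 'n rpoly)"
proof -
  let ?V = "\<lambda>i. (\<lambda>x. x i) ` zero_set d (param d a Q)"
  let ?Z = "{x :: complex ^ 'n. \<forall>i. vec_nth x i * poly_eval (poly_map_of d a Q i) (vec_nth x) = 0}"
  have "vec_nth ` ?Z \<subseteq> zero_set d (param d a Q)"
    by (auto simp: poly_eval_poly_map_of zero_set_def)
  also have "\<dots> \<subseteq> (UNIV \<rightarrow>\<^sub>E (\<Union>i. ?V i))"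
    by auto
  finally have "vec_nth ` ?Z \<subseteq> (UNIV \<rightarrow>\<^sub>E (\<Union>i. ?V i))" .
  moreover have "finite ((UNIV :: 'n set) \<rightarrow>\<^sub>E (\<Union>i. ?V i))"
    by (intro finite_PiE finite_UN_I finite_coordinate_values[OF det] finite)
  ultimately have "finite (vec_nth ` ?Z)" by (rule finite_subset)
  then have "finite ?Z" by (rule finite_imageD) (simp add: inj_on_def vec_eq_iff)
  then show ?thesis by (simp add: is_D0_def)
qed

theorem proposition4p1:
  fixes d :: nat
  shows "\<exists>\<O> :: ('n::finite \<times> 'n monomial \<Rightarrow> real) set.
    openin (powertop_real (param_index d)) \<O> \<and>
    (powertop_real (param_index d)) closure_of \<O> = topspace (powertop_real (param_index d)) \<and>
    semialgebraic (param_index d) \<O> \<and>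
    (\<forall>a Q. param d a Q \<in> \<O> \<longrightarrow> is_D0 (poly_map_of d a Q))"
proof (intro exI conjI allI impI)
  let ?O = "{c \<in> param_index d \<rightarrow>\<^sub>E UNIV. macaulay_det d c \<noteq> 0}
    :: ('n \<times> 'n monomial \<Rightarrow> real) set"
  show "openin (powertop_real (param_index d)) ?O"
    by (rule nonvanishing_open[OF polynomial_on_macaulay_det])
  show "(powertop_real (param_index d)) closure_of ?O = topspace (powertop_real (param_index d))"
    by (rule macaulay_det_nonzero_dense)
  show "semialgebraic (param_index d) ?O"
    by (rule nonvanishing_semialgebraic[OF polynomial_on_macaulay_det])
  show "is_D0 (poly_map_of d a Q)" if "param d a Q \<in> ?O" for a :: "'n \<Rightarrow> real" and Q
    using that by (intro macaulay_det_nonzero_imp_D0) simp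
qed

end
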